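(* Let $(G,b,w)$ be an instance of SFP with $G=(N,E)$. Then $(G,b,w)$ has a stable solution if and only if the linear program $$\max \sum_{ij\in E}w(ij)x(ij)\quad\text{subject to}\quad \sum_{j:ij\in E}x(ij)\le b(i)\ \text{ for each } i\in N,\qquad 0\le x(ij)\le 1\ \text{ for each } ij\in E,$$ has an integral optimal solution.
   Context: An instance of SFP (a multiple partners matching game) is a triple $(G,b,w)$ where $G=(N,E)$ is a finite undirected graph without loops or multiple edges, $b:N\to\mathbb{Z}_{\ge 0}$ is a vertex capacity function, and $w:E\to\mathbb{R}_{\ge 0}$ is an edge weighting. A set $M\subseteq E$ is a $b$-matching if every $i\in N$ is incident to at most $b(i)$ edges of $M$. A function $p:N\times N\to\mathbb{R}_{\ge 0}$ is a payoff vector compatible with $M$ if $p(i,j)+p(j,i)=w(ij)$ for all $ij\in M$ and $p(i,j)=p(j,i)=0$ for all $ij\notin M$. A pair $(M,p)$ with $M$ a $b$-matching and $p$ a payoff vector compatible with $M$ is a solution. The utility function $u_p:N\to\mathbb{R}_{\ge 0}$ is defined by $u_p(i)=\min\{p(i,j): ij\in M\}$ if $i$ is saturated by $M$, i.e. incident with $b(i)$ edges of $M$, and $u_p(i)=0$ otherwise. A solution $(M,p)$ is stable if $u_p(i)+u_p(j)\ge w(ij)$ for all $ij\in E\setminus M$.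
   Formalization: A vertex with b(i)=0 is saturated and its utility is a minimum over the empty set, undefined as a nonnegative real; it is taken to be +infinity, so utilities lie in [0,+infinity]. With value 0 the claim fails (one edge of weight 1, both capacities 0). *)

theory Defs
  imports Complex_Main "HOL-Library.Extended_Real"
begin

(* Edges are two-element vertex sets, so loops and multiple edges are excluded.
   All of b, w, p, x are total functions; only their values on vertices (respectively
   edges, pairs of vertices) of the graph are ever constrained or used. *)

definition simple_graph :: "'a set \<Rightarrow> 'a set set \<Rightarrow> bool" where
  "simple_graph N E \<longleftrightarrow> finite N \<and> (\<forall>e\<in>E. e \<subseteq> N \<and> card e = 2)"

definition sfp_instance :: "'a set \<Rightarrow> 'a set set \<Rightarrow> ('a \<Rightarrow> nat) \<Rightarrow> ('a set \<Rightarrow> real) \<Rightarrow> bool" where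
  "sfp_instance N E b w \<longleftrightarrow> simple_graph N E \<and> (\<forall>e\<in>E. 0 \<le> w e)"

definition b_matching :: "'a set \<Rightarrow> 'a set set \<Rightarrow> ('a \<Rightarrow> nat) \<Rightarrow> 'a set set \<Rightarrow> bool" where
  "b_matching N E b M \<longleftrightarrow> M \<subseteq> E \<and> (\<forall>i\<in>N. card {e \<in> M. i \<in> e} \<le> b i)"

definition compatible_payoff ::
    "'a set \<Rightarrow> ('a set \<Rightarrow> real) \<Rightarrow> 'a set set \<Rightarrow> ('a \<Rightarrow> 'a \<Rightarrow> real) \<Rightarrow> bool" where
  "compatible_payoff N w M p \<longleftrightarrow>
     (\<forall>i\<in>N. \<forall>j\<in>N. 0 \<le> p i j) \<and>
     (\<forall>i\<in>N. \<forall>j\<in>N. {i, j} \<in> M \<longrightarrow> p i j + p j i = w {i, j}) \<and>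
     (\<forall>i\<in>N. \<forall>j\<in>N. {i, j} \<notin> M \<longrightarrow> p i j = 0 \<and> p j i = 0)"

definition solution ::
    "'a set \<Rightarrow> 'a set set \<Rightarrow> ('a \<Rightarrow> nat) \<Rightarrow> ('a set \<Rightarrow> real) \<Rightarrow>
     'a set set \<Rightarrow> ('a \<Rightarrow> 'a \<Rightarrow> real) \<Rightarrow> bool" where
  "solution N E b w M p \<longleftrightarrow> b_matching N E b M \<and> compatible_payoff N w M p"

definition saturated :: "('a \<Rightarrow> nat) \<Rightarrow> 'a set set \<Rightarrow> 'a \<Rightarrow> bool" where
  "saturated b M i \<longleftrightarrow> card {e \<in> M. i \<in> e} = b i"

(* The infimum is over a finite set, hence a minimum unless b i = 0.  A vertex of
   capacity 0 is saturated by the empty set of edges and gets the empty minimum, which is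
   infinity: it can never join a blocking pair.  With a real value such as 0 instead, a
   single edge of weight 1 between vertices of capacity 0 would have no stable solution,
   although x = 0 is then an integral optimum of the linear program. *)
definition utility ::
    "'a set \<Rightarrow> ('a \<Rightarrow> nat) \<Rightarrow> 'a set set \<Rightarrow> ('a \<Rightarrow> 'a \<Rightarrow> real) \<Rightarrow> 'a \<Rightarrow> ereal" where
  "utility N b M p i =
     (if saturated b M i then (INF j\<in>{j \<in> N. {i, j} \<in> M}. ereal (p i j)) else 0)"

definition stable_solution ::
    "'a set \<Rightarrow> 'a set set \<Rightarrow> ('a \<Rightarrow> nat) \<Rightarrow> ('a set \<Rightarrow> real) \<Rightarrow>
     'a set set \<Rightarrow> ('a \<Rightarrow> 'a \<Rightarrow> real) \<Rightarrow> bool" where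
  "stable_solution N E b w M p \<longleftrightarrow> solution N E b w M p \<and>
     (\<forall>i\<in>N. \<forall>j\<in>N. {i, j} \<in> E - M \<longrightarrow>
        utility N b M p i + utility N b M p j \<ge> ereal (w {i, j}))"

definition lp_feasible :: "'a set \<Rightarrow> 'a set set \<Rightarrow> ('a \<Rightarrow> nat) \<Rightarrow> ('a set \<Rightarrow> real) \<Rightarrow> bool" where
  "lp_feasible N E b x \<longleftrightarrow>
     (\<forall>i\<in>N. (\<Sum>j\<in>{j \<in> N. {i, j} \<in> E}. x {i, j}) \<le> real (b i)) \<and>
     (\<forall>e\<in>E. 0 \<le> x e \<and> x e \<le> 1)"

definition lp_optimal ::
    "'a set \<Rightarrow> 'a set set \<Rightarrow> ('a \<Rightarrow> nat) \<Rightarrow> ('a set \<Rightarrow> real) \<Rightarrow> ('a set \<Rightarrow> real) \<Rightarrow> bool" where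
  "lp_optimal N E b w x \<longleftrightarrow> lp_feasible N E b x \<and>
     (\<forall>y. lp_feasible N E b y \<longrightarrow> (\<Sum>e\<in>E. w e * y e) \<le> (\<Sum>e\<in>E. w e * x e))"

definition integral_on_edges :: "'a set set \<Rightarrow> ('a set \<Rightarrow> real) \<Rightarrow> bool" where
  "integral_on_edges E x \<longleftrightarrow> (\<forall>e\<in>E. x e \<in> \<int>)"

end

theory Submission
  imports Defs
begin

text \<open>
  Both sides of the equivalence amount to vertex potentials \<open>y \<ge> 0\<close> that satisfy
  complementary slackness with \<open>M\<close>: \<open>y\<close> vanishes at unsaturated vertices, and
  \<open>y i + y j\<close> is at most \<open>w\<close> on \<open>M\<close> and at least \<open>w\<close> off \<open>M\<close>. Given a stable solution,
  \<open>y\<close> is the utility; given \<open>y\<close>, splitting the surplus \<open>w - y i - y j\<close> of each edge of \<open>M\<close>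
  evenly gives stable payoffs. Weak duality turns \<open>y\<close> into a proof that \<open>M\<close> is optimal.
  Conversely, if the indicator of \<open>M\<close> is optimal, no direction that respects the constraints
  active at \<open>M\<close> increases the objective, and Farkas' lemma writes \<open>w\<close> as a nonnegative
  combination of these constraints, whose coefficients at the vertices form \<open>y\<close>.
\<close>

section \<open>Farkas' lemma\<close>

text \<open>
  The induction follows Bartl: if the functional \<open>f k\<close> is needed, some \<open>z\<close> satisfies the other
  inequalities but has \<open>c z > 0\<close>, and all functionals are projected along \<open>z\<close> onto the
  kernel of \<open>f k\<close>.
\<close>
lemma farkas:
  fixes f :: "'i \<Rightarrow> 'k \<Rightarrow> real" and c :: "'k \<Rightarrow> real"
  assumes "finite I" "finite K"
    and "\<And>z. (\<And>i. i \<in> I \<Longrightarrow> (\<Sum>e\<in>K. f i e * z e) \<le> 0) \<Longrightarrow> (\<Sum>e\<in>K. c e * z e) \<le> 0"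
  shows "\<exists>l. (\<forall>i\<in>I. 0 \<le> l i) \<and> (\<forall>e\<in>K. c e = (\<Sum>i\<in>I. l i * f i e))"
  using assms(1,3)
proof (induction I arbitrary: f c rule: finite_induct)
  case empty
  \<comment> \<open>With no constraints, the test vector \<open>z = c\<close> forces
    \<open>c\<close> to vanish on \<open>K\<close>.\<close>
  have "(\<Sum>e\<in>K. c e * c e) \<le> 0"
    by (rule empty) simp
  then have "(\<Sum>e\<in>K. c e * c e) = 0"
    by (intro antisym sum_nonneg) auto
  then have "\<forall>e\<in>K. c e * c e = 0"
    using \<open>finite K\<close> by (subst (asm) sum_nonneg_eq_0_iff) auto
  then show ?case by simp
next
  case (insert k I)
  show ?case
  proof (cases "\<forall>z. (\<forall>i\<in>I. (\<Sum>e\<in>K. f i e * z e) \<le> 0) \<longrightarrow> (\<Sum>e\<in>K. c e * z e) \<le> 0")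
    case True
    then obtain l where l: "\<forall>i\<in>I. 0 \<le> l i" "\<forall>e\<in>K. c e = (\<Sum>i\<in>I. l i * f i e)"
      using insert.IH[of f c] by blast
    have "(\<Sum>i\<in>I. (l(k := 0)) i * f i e) = (\<Sum>i\<in>I. l i * f i e)" for e
      using insert.hyps by (intro sum.cong) auto
    then have "\<forall>e\<in>K. c e = (\<Sum>i\<in>insert k I. (l(k := 0)) i * f i e)"
      using l insert.hyps by simp
    then show ?thesis
      using l by (intro exI[of _ "l(k := 0)"]) auto
  next
    case False
    then obtain z1 where z1: "\<forall>i\<in>I. (\<Sum>e\<in>K. f i e * z1 e) \<le> 0" "(\<Sum>e\<in>K. c e * z1 e) > 0"
      by force
    define s where "s = (\<Sum>e\<in>K. f k e * z1 e)"
    \<comment> \<open>Otherwise \<open>z1\<close> would satisfy the inequality for \<open>k\<close>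
      too, against the hypothesis. Dividing by \<open>s\<close> then normalises the value of
      \<open>f k\<close> to 1.\<close>
    have s: "s > 0"
    proof (rule ccontr)
      assume "\<not> s > 0"
      then have "(\<Sum>e\<in>K. c e * z1 e) \<le> 0"
        using z1(1) by (intro insert.prems) (auto simp: s_def)
      then show False using z1(2) by simp
    qed
    define z0 where "z0 e = z1 e / s" for e
    have scale: "(\<Sum>e\<in>K. g e * z0 e) = (\<Sum>e\<in>K. g e * z1 e) / s" for g
      by (simp add: z0_def sum_divide_distrib)
    define F where "F g = (\<Sum>e\<in>K. g e * z0 e)" for g
    have Fk: "F (f k) = 1" and Fi: "\<And>i. i \<in> I \<Longrightarrow> F (f i) \<le> 0" and Fc: "F c > 0"
      using s z1 unfolding F_def scale by (auto simp: s_def[symmetric] divide_nonpos_pos)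
    \<comment> \<open>Evaluating \<open>P g\<close> at \<open>z\<close> is evaluating
      \<open>g\<close> at \<open>z - (f k)(z) * z0\<close>, which lies in the kernel of
      \<open>f k\<close> because \<open>F (f k) = 1\<close>.\<close>
    define P where "P g e = g e - F g * f k e" for g e
    have P: "(\<Sum>e\<in>K. P g e * z e)
        = (\<Sum>e\<in>K. g e * (z e - (\<Sum>e\<in>K. f k e * z e) * z0 e))" for g z
      by (simp add: P_def F_def algebra_simps sum_subtractf sum_distrib_left sum_distrib_right)
        (subst sum.swap, simp add: algebra_simps)
    have "\<exists>l. (\<forall>i\<in>I. 0 \<le> l i) \<and> (\<forall>e\<in>K. P c e = (\<Sum>i\<in>I. l i * P (f i) e))"
    proof (rule insert.IH)
      fix z assume z: "\<And>i. i \<in> I \<Longrightarrow> (\<Sum>e\<in>K. P (f i) e * z e) \<le> 0"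
      have "(\<Sum>e\<in>K. P (f k) e * z e) = 0"
        by (simp add: P_def Fk)
      then show "(\<Sum>e\<in>K. P c e * z e) \<le> 0"
        unfolding P using z by (intro insert.prems) (auto simp: P[symmetric])
    qed
    then obtain l where l: "\<forall>i\<in>I. 0 \<le> l i" "\<forall>e\<in>K. P c e = (\<Sum>i\<in>I. l i * P (f i) e)"
      by blast
    \<comment> \<open>Expanding \<open>P\<close> in the identity for \<open>P c\<close> and
      collecting the multiples of \<open>f k\<close> leaves exactly this coefficient.\<close>
    define m where "m = F c - (\<Sum>i\<in>I. l i * F (f i))"
    have "(\<Sum>i\<in>I. l i * F (f i)) \<le> 0"
      using l Fi by (intro sum_nonpos) (auto intro: mult_nonneg_nonpos)
    then have m: "m \<ge> 0" using Fc by (simp add: m_def)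
    have upd: "(\<Sum>i\<in>I. (l(k := m)) i * f i e) = (\<Sum>i\<in>I. l i * f i e)" for e
      using insert.hyps by (intro sum.cong) auto
    have "c e = (\<Sum>i\<in>insert k I. (l(k := m)) i * f i e)" if "e \<in> K" for e
    proof -
      have "c e - F c * f k e = (\<Sum>i\<in>I. l i * f i e) - (\<Sum>i\<in>I. l i * F (f i)) * f k e"
        using l that by (simp add: P_def algebra_simps sum_subtractf sum_distrib_left)
      then show ?thesis
        using insert.hyps upd by (simp add: m_def algebra_simps)
    qed
    then show ?thesis
      using l m by (intro exI[of _ "l(k := m)"]) auto
  qed
qed

section \<open>Sums over edges and incidences\<close>

lemma simple_graph_finite_edges:
  assumes "simple_graph N E"
  shows "finite E"
  using assms by (auto simp: simple_graph_def intro: finite_subset[of E "Pow N"])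

lemma simple_graph_edgeE:
  assumes "simple_graph N E" "e \<in> E"
  obtains i j where "e = {i, j}" "i \<noteq> j" "i \<in> N" "j \<in> N"
  using assms unfolding simple_graph_def card_2_iff by fastforce

lemma simple_graph_loopless:
  assumes "simple_graph N E" "{i, j} \<in> E"
  shows "i \<noteq> j"
  using assms unfolding simple_graph_def by fastforce

lemma sum_neighbours:
  assumes G: "simple_graph N E" and "i \<in> N"
  shows "(\<Sum>j\<in>{j \<in> N. {i, j} \<in> E}. x {i, j}) = (\<Sum>e\<in>{e \<in> E. i \<in> e}. x e)"
proof (rule sum.reindex_bij_betw)
  have "e \<in> (\<lambda>j. {i, j}) ` {j \<in> N. {i, j} \<in> E}" if "e \<in> E" "i \<in> e" for e
    using simple_graph_edgeE[OF G \<open>e \<in> E\<close>] that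
    by (smt (verit) doubleton_eq_iff empty_iff image_iff insert_iff mem_Collect_eq)
  then show "bij_betw (\<lambda>j. {i, j}) {j \<in> N. {i, j} \<in> E} {e \<in> E. i \<in> e}"
    by (auto simp: bij_betw_def inj_on_def doubleton_eq_iff)
qed

text \<open>Double counting: exchanging the sums over edges and their ends groups the terms by
  vertex, where the capacity constraints apply.\<close>

lemma sum_incidence:
  fixes y :: "'a \<Rightarrow> real"
  assumes G: "simple_graph N E"
  shows "(\<Sum>e\<in>E. sum y e * g e) = (\<Sum>i\<in>N. y i * (\<Sum>e\<in>{e \<in> E. i \<in> e}. g e))"
proof -
  have "(\<Sum>e\<in>E. sum y e * g e) = (\<Sum>e\<in>E. \<Sum>i\<in>{i \<in> N. i \<in> e}. y i * g e)"
  proof (rule sum.cong[OF refl])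
    fix e assume "e \<in> E"
    then have "{i \<in> N. i \<in> e} = e"
      using G by (auto simp: simple_graph_def)
    then show "sum y e * g e = (\<Sum>i\<in>{i \<in> N. i \<in> e}. y i * g e)"
      by (simp add: sum_distrib_right)
  qed
  also have "\<dots> = (\<Sum>i\<in>N. \<Sum>e\<in>{e \<in> E. i \<in> e}. y i * g e)"
    using G simple_graph_finite_edges[OF G] by (intro sum.swap_restrict) (auto simp: simple_graph_def)
  finally show ?thesis
    by (simp add: sum_distrib_left)
qed

lemma sum_indicator_degree:
  assumes "finite E" "M \<subseteq> E"
  shows "(\<Sum>e\<in>{e \<in> E. i \<in> e}. of_bool (e \<in> M)) = real (card {e \<in> M. i \<in> e})"
proof -
  have "{e \<in> E. i \<in> e} \<inter> {e. e \<in> M} = {e \<in> M. i \<in> e}"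
    using assms by auto
  then show ?thesis
    using assms by (simp add: sum.If_cases of_bool_def)
qed

section \<open>The linear program and indicators of edge sets\<close>

lemma lp_feasible_iff:
  assumes "simple_graph N E"
  shows "lp_feasible N E b x \<longleftrightarrow>
    (\<forall>i\<in>N. (\<Sum>e\<in>{e \<in> E. i \<in> e}. x e) \<le> real (b i)) \<and> (\<forall>e\<in>E. 0 \<le> x e \<and> x e \<le> 1)"
  unfolding lp_feasible_def using sum_neighbours[OF assms, where x = x] by simp

lemma lp_feasible_indicator_iff:
  assumes "simple_graph N E" "M \<subseteq> E"
  shows "lp_feasible N E b (\<lambda>e. of_bool (e \<in> M)) \<longleftrightarrow> b_matching N E b M"
  using assms sum_indicator_degree[OF simple_graph_finite_edges[OF assms(1)] assms(2)]
  by (simp add: lp_feasible_iff b_matching_def)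

lemma lp_optimal_cong:
  assumes "simple_graph N E" "\<And>e. e \<in> E \<Longrightarrow> x e = x' e"
  shows "lp_optimal N E b w x \<longleftrightarrow> lp_optimal N E b w x'"
proof -
  have "(\<Sum>e\<in>{e \<in> E. i \<in> e}. x e) = (\<Sum>e\<in>{e \<in> E. i \<in> e}. x' e)" for i
    using assms(2) by (intro sum.cong) auto
  moreover have "(\<Sum>e\<in>E. w e * x e) = (\<Sum>e\<in>E. w e * x' e)"
    using assms(2) by (intro sum.cong) auto
  ultimately show ?thesis
    using assms by (simp add: lp_optimal_def lp_feasible_iff)
qed

section \<open>Potentials and optimality\<close>

text \<open>
  The dual variable of the constraint \<open>x e \<le> 1\<close> is eliminated: it is \<open>w e - sum y e\<close> on \<open>M\<close>
  and \<open>0\<close> elsewhere.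
\<close>
definition slack_potential ::
    "'a set \<Rightarrow> 'a set set \<Rightarrow> ('a \<Rightarrow> nat) \<Rightarrow> ('a set \<Rightarrow> real) \<Rightarrow> 'a set set \<Rightarrow> ('a \<Rightarrow> real) \<Rightarrow> bool" where
  "slack_potential N E b w M y \<longleftrightarrow>
     (\<forall>i\<in>N. 0 \<le> y i \<and> (\<not> saturated b M i \<longrightarrow> y i = 0)) \<and>
     (\<forall>e\<in>M. sum y e \<le> w e) \<and> (\<forall>e\<in>E - M. w e \<le> sum y e)"

lemma lp_optimal_if_slack_potential:
  assumes G: "simple_graph N E" and M: "b_matching N E b M" and y: "slack_potential N E b w M y"
  shows "lp_optimal N E b w (\<lambda>e. of_bool (e \<in> M))"
  unfolding lp_optimal_def
proof (intro conjI allI impI)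
  have ME: "M \<subseteq> E" using M by (simp add: b_matching_def)
  show "lp_feasible N E b (\<lambda>e. of_bool (e \<in> M))"
    using lp_feasible_indicator_iff[OF G ME] M by simp
  fix x assume x: "lp_feasible N E b x"
  \<comment> \<open>On \<open>M\<close> this difference is at most 0 and \<open>w e\<close> is at
    least \<open>sum y e\<close>; off \<open>M\<close> both signs flip. So replacing
    \<open>w\<close> by \<open>sum y\<close> can only increase the sum.\<close>
  let ?g = "\<lambda>e. x e - of_bool (e \<in> M)"
  have "w e * ?g e \<le> sum y e * ?g e" if "e \<in> E" for e
  proof -
    have "0 \<le> x e" "x e \<le> 1"
      using x that by (auto simp: lp_feasible_def)
    then show ?thesis
      using y that unfolding slack_potential_def
      by (cases "e \<in> M") (auto intro: mult_right_mono mult_right_mono_neg)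
  qed
  then have "(\<Sum>e\<in>E. w e * ?g e) \<le> (\<Sum>e\<in>E. sum y e * ?g e)"
    by (rule sum_mono)
  also have "\<dots> = (\<Sum>i\<in>N. y i * (\<Sum>e\<in>{e \<in> E. i \<in> e}. ?g e))"
    by (rule sum_incidence[OF G])
  also have "\<dots> \<le> 0"
  proof (rule sum_nonpos)
    fix i assume i: "i \<in> N"
    show "y i * (\<Sum>e\<in>{e \<in> E. i \<in> e}. ?g e) \<le> 0"
    proof (cases "saturated b M i")
      case True
      then have "(\<Sum>e\<in>{e \<in> E. i \<in> e}. ?g e) \<le> 0"
        using x i sum_indicator_degree[OF simple_graph_finite_edges[OF G] ME, of i]
        by (simp add: sum_subtractf lp_feasible_iff[OF G] saturated_def)
      then show ?thesis
        using y i by (simp add: slack_potential_def mult_nonneg_nonpos)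
    qed (use y i in \<open>simp add: slack_potential_def\<close>)
  qed
  finally show "(\<Sum>e\<in>E. w e * x e) \<le> (\<Sum>e\<in>E. w e * of_bool (e \<in> M))"
    by (simp add: algebra_simps sum_subtractf)
qed

text \<open>The hypotheses on \<open>z\<close> say that it violates no constraint active at the
  indicator of \<open>M\<close>. A small step along \<open>z\<close> then stays feasible, so it
  cannot improve the optimum.\<close>

lemma lp_optimal_feasible_direction:
  assumes G: "simple_graph N E" and M: "b_matching N E b M"
    and opt: "lp_optimal N E b w (\<lambda>e. of_bool (e \<in> M))"
    and sat: "\<And>i. i \<in> N \<Longrightarrow> saturated b M i \<Longrightarrow> (\<Sum>e\<in>{e \<in> E. i \<in> e}. z e) \<le> 0"
    and inM: "\<And>e. e \<in> M \<Longrightarrow> z e \<le> 0" and notM: "\<And>e. e \<in> E - M \<Longrightarrow> 0 \<le> z e"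
  shows "(\<Sum>e\<in>E. w e * z e) \<le> 0"
proof -
  have ME: "M \<subseteq> E" using M by (simp add: b_matching_def)
  have fin: "finite E" by (rule simple_graph_finite_edges[OF G])
  \<comment> \<open>Slack constraints at an integral point have slack at least \<open>1\<close>, so this step size is safe.\<close>
  define t where "t = inverse (1 + (\<Sum>e\<in>E. \<bar>z e\<bar>))"
  have pos: "1 + (\<Sum>e\<in>E. \<bar>z e\<bar>) > 0"
    by (intro add_pos_nonneg sum_nonneg) auto
  then have t: "t > 0" by (simp add: t_def)
  have small: "\<bar>t * (\<Sum>e\<in>A. z e)\<bar> \<le> 1" if "A \<subseteq> E" for A
  proof -
    have "\<bar>\<Sum>e\<in>A. z e\<bar> \<le> (\<Sum>e\<in>E. \<bar>z e\<bar>)"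
      by (rule order.trans[OF sum_abs sum_mono2[OF fin that]]) auto
    then show ?thesis
      using t pos by (simp add: abs_mult t_def field_simps)
  qed
  let ?x = "\<lambda>e. of_bool (e \<in> M) + t * z e"
  have "lp_feasible N E b ?x"
    unfolding lp_feasible_iff[OF G]
  proof (intro conjI ballI)
    fix i assume i: "i \<in> N"
    have deg: "(\<Sum>e\<in>{e \<in> E. i \<in> e}. ?x e)
        = real (card {e \<in> M. i \<in> e}) + t * (\<Sum>e\<in>{e \<in> E. i \<in> e}. z e)"
      using sum_indicator_degree[OF fin ME] by (simp add: sum.distrib sum_distrib_left)
    show "(\<Sum>e\<in>{e \<in> E. i \<in> e}. ?x e) \<le> real (b i)"
    proof (cases "saturated b M i")
      case True
      then have "t * (\<Sum>e\<in>{e \<in> E. i \<in> e}. z e) \<le> 0"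
        using sat[OF i] t by (simp add: mult_nonneg_nonpos)
      then show ?thesis
        unfolding deg using True by (simp add: saturated_def)
    next
      case False
      then have "card {e \<in> M. i \<in> e} + 1 \<le> b i"
        using M i by (auto simp: saturated_def b_matching_def le_less)
      then show ?thesis
        unfolding deg using small[of "{e \<in> E. i \<in> e}"] by fastforce
    qed
  next
    fix e assume e: "e \<in> E"
    have "\<bar>t * z e\<bar> \<le> 1" using small[of "{e}"] e by simp
    moreover have "t * z e \<le> 0" if "e \<in> M"
      using inM[OF that] t by (simp add: mult_nonneg_nonpos)
    moreover have "t * z e \<ge> 0" if "e \<notin> M"
      using notM that e t by simp
    ultimately show "0 \<le> ?x e" "?x e \<le> 1"
      by (auto simp: of_bool_def)
  qed
  then have "(\<Sum>e\<in>E. w e * ?x e) \<le> (\<Sum>e\<in>E. w e * of_bool (e \<in> M))"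
    using opt by (simp add: lp_optimal_def)
  moreover have "(\<Sum>e\<in>E. w e * ?x e)
      = (\<Sum>e\<in>E. w e * of_bool (e \<in> M)) + t * (\<Sum>e\<in>E. w e * z e)"
    unfolding sum_distrib_left sum.distrib[symmetric]
    by (intro sum.cong) (auto simp: algebra_simps)
  ultimately have "t * (\<Sum>e\<in>E. w e * z e) \<le> 0" by simp
  then show ?thesis using t by (simp add: mult_le_0_iff)
qed

lemma slack_potential_if_lp_optimal:
  assumes G: "simple_graph N E" and M: "b_matching N E b M"
    and opt: "lp_optimal N E b w (\<lambda>e. of_bool (e \<in> M))"
  obtains y where "slack_potential N E b w M y"
proof -
  have ME: "M \<subseteq> E" using M by (simp add: b_matching_def)
  have fin: "finite E" by (rule simple_graph_finite_edges[OF G])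
  define S where "S = {i \<in> N. saturated b M i}"
  have finS: "finite S" using G by (simp add: S_def simple_graph_def)
  \<comment> \<open>The active bound of an edge is \<open>x e \<le> 1\<close> on \<open>M\<close>
    and \<open>0 \<le> x e\<close> off \<open>M\<close>; the sign turns both into the form "at most
    0" that Farkas' lemma takes.\<close>
  define sgn :: "'a set \<Rightarrow> real" where "sgn e = (if e \<in> M then 1 else -1)" for e
  define f :: "'a + 'a set \<Rightarrow> 'a set \<Rightarrow> real" where
    "f k e = (case k of Inl i \<Rightarrow> of_bool (i \<in> e) | Inr e' \<Rightarrow> of_bool (e = e') * sgn e)" for k e
  have fl: "(\<Sum>e\<in>E. f (Inl i) e * z e) = (\<Sum>e\<in>{e \<in> E. i \<in> e}. z e)" for i z
    unfolding sum.inter_filter[OF fin] by (intro sum.cong) (auto simp: f_def)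
  have fr: "(\<Sum>e\<in>E. f (Inr e') e * z e) = sgn e' * z e'" if "e' \<in> E" for e' z
  proof -
    have "(\<Sum>e\<in>E. f (Inr e') e * z e) = (\<Sum>e\<in>E. if e = e' then sgn e * z e else 0)"
      by (intro sum.cong) (auto simp: f_def)
    then show ?thesis using that fin by simp
  qed
  have "\<exists>l. (\<forall>k\<in>S <+> E. 0 \<le> l k) \<and> (\<forall>e\<in>E. w e = (\<Sum>k\<in>S <+> E. l k * f k e))"
  proof (rule farkas)
    fix z assume z: "\<And>k. k \<in> S <+> E \<Longrightarrow> (\<Sum>e\<in>E. f k e * z e) \<le> 0"
    have zE: "sgn e * z e \<le> 0" if "e \<in> E" for e
      using z[of "Inr e"] fr[OF that] that by auto
    show "(\<Sum>e\<in>E. w e * z e) \<le> 0"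
    proof (rule lp_optimal_feasible_direction[OF G M opt])
      show "(\<Sum>e\<in>{e \<in> E. i \<in> e}. z e) \<le> 0" if "i \<in> N" "saturated b M i" for i
        using z[of "Inl i"] fl[of i z] that by (auto simp: S_def)
      show "z e \<le> 0" if "e \<in> M" for e
        using zE[of e] that ME by (auto simp: sgn_def)
      show "0 \<le> z e" if "e \<in> E - M" for e
        using zE[of e] that by (auto simp: sgn_def)
    qed
  qed (use fin finS in auto)
  then obtain l where l0: "\<forall>k\<in>S <+> E. 0 \<le> l k"
    and l: "\<forall>e\<in>E. w e = (\<Sum>k\<in>S <+> E. l k * f k e)"
    by (elim exE conjE)
  define y where "y i = (if i \<in> S then l (Inl i) else 0)" for i
  \<comment> \<open>The functional of an edge is nonzero only at that edge, so the nonnegative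
    \<open>l (Inr e)\<close> alone decides on which side of \<open>sum y e\<close> the weight
    lies.\<close>
  have w: "w e = sum y e + l (Inr e) * sgn e" if e: "e \<in> E" for e
  proof -
    have eN: "e \<subseteq> N" "finite e"
      using G e by (auto simp: simple_graph_def intro: finite_subset)
    have "(\<Sum>i\<in>S. l (Inl i) * f (Inl i) e) = (\<Sum>i\<in>S \<inter> e. l (Inl i))"
      unfolding sum.inter_restrict[OF finS] by (intro sum.cong) (auto simp: f_def)
    also have "\<dots> = sum y e"
      using eN by (subst Int_commute, subst sum.inter_restrict) (auto intro!: sum.cong simp: y_def)
    finally have 1: "(\<Sum>i\<in>S. l (Inl i) * f (Inl i) e) = sum y e" .
    have "(\<Sum>e'\<in>E. l (Inr e') * f (Inr e') e) = (\<Sum>e'\<in>E. if e' = e then l (Inr e) * sgn e else 0)"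
      by (intro sum.cong) (auto simp: f_def)
    then have 2: "(\<Sum>e'\<in>E. l (Inr e') * f (Inr e') e) = l (Inr e) * sgn e"
      using fin e by simp
    show ?thesis
      using l e finS fin 1 2 by (simp add: sum.Plus)
  qed
  have "slack_potential N E b w M y"
    unfolding slack_potential_def
  proof (intro conjI ballI impI)
    show "0 \<le> y i" if "i \<in> N" for i
      using l0 by (auto simp: y_def)
    show "y i = 0" if "i \<in> N" "\<not> saturated b M i" for i
      using that by (simp add: y_def S_def)
    show "sum y e \<le> w e" if "e \<in> M" for e
      using w[of e] bspec[OF l0, of "Inr e"] that subsetD[OF ME that] by (auto simp: sgn_def)
    show "w e \<le> sum y e" if "e \<in> E - M" for e
      using w[of e] bspec[OF l0, of "Inr e"] that by (auto simp: sgn_def)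
  qed
  then show ?thesis by (rule that)
qed

section \<open>Potentials and stable solutions\<close>

lemma slack_potential_if_stable:
  assumes inst: "sfp_instance N E b w" and st: "stable_solution N E b w M p"
  obtains y where "slack_potential N E b w M y"
proof -
  have G: "simple_graph N E" and w: "\<And>e. e \<in> E \<Longrightarrow> 0 \<le> w e"
    using inst by (auto simp: sfp_instance_def)
  have fin: "finite E" by (rule simple_graph_finite_edges[OF G])
  have M: "b_matching N E b M" and p: "compatible_payoff N w M p"
    using st by (auto simp: stable_solution_def solution_def)
  have ME: "M \<subseteq> E" using M by (simp add: b_matching_def)
  \<comment> \<open>The total weight serves as a finite stand-in for infinite utility: it covers
    every edge weight by itself.\<close>
  have W: "w e \<le> sum w E" if "e \<in> E" for e
    using member_le_sum[of e E w] that w fin by auto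
  have W0: "0 \<le> sum w E" using w by (rule sum_nonneg)
  define u where "u i = utility N b M p i" for i
  \<comment> \<open>A saturated vertex of capacity \<open>0\<close> has infinite utility; any large real will do.\<close>
  define y where "y i = (if u i = \<infinity> then sum w E else real_of_ereal (u i))" for i
  have u0: "0 \<le> u i" if "i \<in> N" for i
    using p that by (auto simp: u_def utility_def compatible_payoff_def intro!: INF_greatest)
  have y: "0 \<le> y i" "u i \<noteq> \<infinity> \<Longrightarrow> ereal (y i) = u i" if "i \<in> N" for i
    using u0[OF that] W0 by (cases "u i"; simp add: y_def)+
  \<comment> \<open>An end of an edge of \<open>M\<close> has utility bounded by its share, hence
    finite, so the stand-in value never occurs here.\<close>
  have yp: "y i \<le> p i j" if "i \<in> N" "j \<in> N" "{i, j} \<in> M" for i j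
  proof -
    have "u i \<le> ereal (p i j)"
      using p that unfolding u_def utility_def compatible_payoff_def
      by (auto intro!: INF_lower)
    then show ?thesis
      using y(2)[OF \<open>i \<in> N\<close>] by (cases "u i") auto
  qed
  have "slack_potential N E b w M y"
    unfolding slack_potential_def
  proof (intro conjI ballI impI)
    show "0 \<le> y i" if "i \<in> N" for i by (rule y(1)[OF that])
    show "y i = 0" if "\<not> saturated b M i" for i
      using that by (simp add: y_def u_def utility_def)
    show "sum y e \<le> w e" if "e \<in> M" for e
    proof -
      have "e \<in> E" using that ME by blast
      then obtain i j where e: "e = {i, j}" "i \<noteq> j" "i \<in> N" "j \<in> N"
        by (rule simple_graph_edgeE[OF G])
      then have "p i j + p j i = w e"
        using p that by (simp add: compatible_payoff_def)
      then show ?thesis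
        using yp[of i j] yp[of j i] e that by (simp add: insert_commute)
    qed
    show "w e \<le> sum y e" if eE: "e \<in> E - M" for e
    proof -
      have "e \<in> E" using eE by blast
      then obtain i j where e: "e = {i, j}" "i \<noteq> j" "i \<in> N" "j \<in> N"
        by (rule simple_graph_edgeE[OF G])
      then have uu: "ereal (w e) \<le> u i + u j"
        using st eE by (auto simp: stable_solution_def u_def)
      show ?thesis
      proof (cases "u i = \<infinity> \<or> u j = \<infinity>")
        case True
        then show ?thesis
          using W[of e] eE y(1)[OF e(3)] y(1)[OF e(4)] e(1,2) by (auto simp: y_def)
      next
        case False
        then have "ereal (w e) \<le> ereal (y i) + ereal (y j)"
          using uu y(2) e by simp
        then show ?thesis using e by simp
      qed
    qed
  qed
  then show ?thesis by (rule that)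
qed

lemma stable_if_slack_potential:
  assumes G: "simple_graph N E" and M: "b_matching N E b M" and y: "slack_potential N E b w M y"
  obtains p where "stable_solution N E b w M p"
proof -
  have ME: "M \<subseteq> E" using M by (simp add: b_matching_def)
  define p where "p i j = (if {i, j} \<in> M then y i + (w {i, j} - sum y {i, j}) / 2 else 0)" for i j
  have y0: "0 \<le> y i" if "i \<in> N" for i
    using y that by (simp add: slack_potential_def)
  have py: "y i \<le> p i j" if "{i, j} \<in> M" for i j
    using y that by (auto simp: p_def slack_potential_def)
  have "p i j + p j i = w {i, j}" if "{i, j} \<in> M" for i j
  proof -
    \<comment> \<open>For \<open>i = j\<close> the set \<open>{i, j}\<close> would collapse and
      \<open>sum y {i, j}\<close> would count \<open>y i\<close> once, so the shares would not add
      up to the weight.\<close>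
    have "i \<noteq> j" using simple_graph_loopless[OF G] that ME by blast
    then show ?thesis
      using that by (simp add: p_def insert_commute[of j i])
  qed
  moreover have "0 \<le> p i j" if "i \<in> N" for i j
    using py[of i j] y0[OF that] by (cases "{i, j} \<in> M") (auto simp: p_def)
  ultimately have pay: "compatible_payoff N w M p"
    by (auto simp: compatible_payoff_def p_def insert_commute)
  \<comment> \<open>At a saturated vertex every share is at least \<open>y i\<close>, and an empty
    infimum is infinite; at an unsaturated one both sides are 0.\<close>
  have u: "ereal (y i) \<le> utility N b M p i" if "i \<in> N" for i
    using y that py by (auto simp: utility_def slack_potential_def intro!: INF_greatest)
  have "stable_solution N E b w M p"
    unfolding stable_solution_def solution_def
  proof (intro conjI ballI impI M pay)
    fix i j assume ij: "i \<in> N" "j \<in> N" "{i, j} \<in> E - M"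
    then have "i \<noteq> j" using simple_graph_loopless[OF G] by blast
    then have "sum y {i, j} = y i + y j" by simp
    moreover have "w {i, j} \<le> sum y {i, j}"
      using y ij(3) unfolding slack_potential_def by blast
    ultimately have "ereal (w {i, j}) \<le> ereal (y i) + ereal (y j)" by simp
    also have "\<dots> \<le> utility N b M p i + utility N b M p j"
      using u ij by (intro add_mono) auto
    finally show "utility N b M p i + utility N b M p j \<ge> ereal (w {i, j})" .
  qed
  then show ?thesis by (rule that)
qed

theorem theorem4:
  fixes N :: "'a set" and E :: "'a set set"
    and b :: "'a \<Rightarrow> nat" and w :: "'a set \<Rightarrow> real"
  assumes "sfp_instance N E b w"
  shows "(\<exists>M p. stable_solution N E b w M p) \<longleftrightarrow>
         (\<exists>x. lp_optimal N E b w x \<and> integral_on_edges E x)"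
proof -
  have G: "simple_graph N E" using assms by (simp add: sfp_instance_def)
  show ?thesis
  proof (intro iffI; elim exE conjE)
    fix M p assume st: "stable_solution N E b w M p"
    then have "b_matching N E b M"
      by (simp add: stable_solution_def solution_def)
    then have "lp_optimal N E b w (\<lambda>e. of_bool (e \<in> M))"
      using slack_potential_if_stable[OF assms st] lp_optimal_if_slack_potential[OF G] by metis
    then show "\<exists>x. lp_optimal N E b w x \<and> integral_on_edges E x"
      by (auto simp: integral_on_edges_def of_bool_def)
  next
    fix x assume opt: "lp_optimal N E b w x" and int: "integral_on_edges E x"
    \<comment> \<open>An integer between 0 and 1 is 0 or 1, so on \<open>E\<close> the optimum
      \<open>x\<close> is the indicator of this set; its values elsewhere do not matter by
      \<open>lp_optimal_cong\<close>.\<close>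
    define M where "M = {e \<in> E. x e = 1}"
    have ME: "M \<subseteq> E" by (auto simp: M_def)
    have x: "x e = of_bool (e \<in> M)" if "e \<in> E" for e
    proof -
      have "x e \<in> \<int>" "0 \<le> x e" "x e \<le> 1"
        using opt int that by (auto simp: integral_on_edges_def lp_optimal_def lp_feasible_def)
      then obtain k :: int where "x e = of_int k" "0 \<le> k" "k \<le> 1"
        by (auto elim!: Ints_cases)
      then show ?thesis
        using that by (cases "k = 0") (auto simp: M_def)
    qed
    have optM: "lp_optimal N E b w (\<lambda>e. of_bool (e \<in> M))"
      using opt lp_optimal_cong[OF G x] by simp
    then have M: "b_matching N E b M"
      using lp_feasible_indicator_iff[OF G ME] by (simp add: lp_optimal_def)
    show "\<exists>M p. stable_solution N E b w M p"
      using slack_potential_if_lp_optimal[OF G M optM] stable_if_slack_potential[OF G M] by metis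
  qed
qed

end
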